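(* Let $n\ge3$ be odd, $r=\lfloor n/2\rfloor$, and let $D=(d_{ij})\in\mathcal S^n$, where $d_{ij}$ is the cost of edge $\{i,j\}$ of the complete graph $K_n$. Then the mixed-integer semidefinite program in the variables $X_1,\dots,X_r$ $$\min\;\tfrac12\langle D,X_1\rangle\quad\text{s.t.}\quad \mathbf I_n+\sum_{i=1}^rX_i=\mathbf J_n,\quad \mathbf I_n+\sum_{i=1}^r\cos\!\left(\tfrac{2ij\pi}{n}\right)X_i\succeq\mathbf 0\ \ \forall j\in[r],$$ $$X_1=X_1^\top\in\{0,1\}^{n\times n},\quad X_i\ge\mathbf 0,\ X_i\in\mathcal S^n\ \ \forall i=2,\dots,r$$ is an exact formulation of the traveling salesman problem on $K_n$ with cost matrix $D$.
   Context: The traveling salesman problem (TSP) asks for a Hamiltonian cycle of minimum total cost in the complete graph $K_n$ on $n$ vertices. The program is an exact formulation of the TSP if every Hamiltonian cycle of $K_n$ yields a feasible solution of the program whose objective value is the cost of the cycle, and every feasible solution of the program yields a Hamiltonian cycle whose cost equals the objective value. $[r]=\{1,\dots,r\}$; $\mathcal S^n$ is the set of real symmetric $n\times n$ matrices; $\mathbf I_n$ and $\mathbf J_n$ are the identity and the all-ones matrix of order $n$; $\langle X,Y\rangle=\operatorname{tr}(X^\top Y)$; $\succeq\mathbf 0$ means positive semidefinite; $X\ge\mathbf 0$ is entrywise. *)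

theory Defs
  imports "HOL-Analysis.Analysis"
begin

definition symmetric_matrix :: "real^'n^'n \<Rightarrow> bool" where
  "symmetric_matrix A \<longleftrightarrow> transpose A = A"

definition psd :: "real^'n^'n \<Rightarrow> bool" where
  "psd A \<longleftrightarrow> symmetric_matrix A \<and> (\<forall>x. 0 \<le> x \<bullet> (A *v x))"

definition nonneg_matrix :: "real^'n^'n \<Rightarrow> bool" where
  "nonneg_matrix A \<longleftrightarrow> (\<forall>i j. 0 \<le> A $ i $ j)"

definition binary_matrix :: "real^'n^'n \<Rightarrow> bool" where
  "binary_matrix A \<longleftrightarrow> (\<forall>i j. A $ i $ j \<in> {0, 1})"

definition identity_matrix :: "real^'n^'n" where
  "identity_matrix = mat 1"

definition all_ones_matrix :: "real^'n^'n" where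
  "all_ones_matrix = (\<chi> i j. 1)"

definition trace_inner :: "real^'n^'n \<Rightarrow> real^'n^'n \<Rightarrow> real" where
  "trace_inner X Y = trace (transpose X ** Y)"

text \<open>Edges are two-element vertex sets. The vertex set is the whole finite type.\<close>

definition complete_graph_edges :: "'v set set" where
  "complete_graph_edges = {{u, v} | u v. u \<noteq> v}"

definition closed_walk_edges :: "'v list \<Rightarrow> 'v set set" where
  "closed_walk_edges vs =
     {{vs ! k, vs ! (Suc k mod length vs)} | k. k < length vs}"

text \<open>A Hamiltonian cycle is identified with its edge set, so that cyclic rotations and
  reversals of a vertex ordering give the same cycle.\<close>

definition hamiltonian_cycle :: "'v set set \<Rightarrow> 'v set set \<Rightarrow> bool" where
  "hamiltonian_cycle E C \<longleftrightarrow>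
     C \<subseteq> E \<and>
     (\<exists>vs. distinct vs \<and> set vs = UNIV \<and> 3 \<le> length vs \<and> C = closed_walk_edges vs)"

text \<open>The cost of an edge \<open>{i, j}\<close> is the entry \<open>D $ i $ j\<close>, which
  is independent of the order of the endpoints only for symmetric \<open>D\<close>.\<close>

definition edge_cost :: "real^'n^'n \<Rightarrow> 'n set \<Rightarrow> real" where
  "edge_cost D e = (THE c. \<exists>i j. e = {i, j} \<and> c = D $ i $ j)"

lemma edge_cost_eq:
  assumes "symmetric_matrix D"
  shows "edge_cost D {i, j} = D $ i $ j"
proof -
  have sym: "D $ u $ v = D $ v $ u" for u v
    using assms unfolding symmetric_matrix_def transpose_def
    by (metis (no_types, lifting) vec_lambda_beta)
  show ?thesis
    unfolding edge_cost_def
    by (rule the_equality) (use sym in \<open>auto simp: doubleton_eq_iff\<close>)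
qed

definition cycle_cost :: "real^'n^'n \<Rightarrow> 'n set set \<Rightarrow> real" where
  "cycle_cost D C = (\<Sum>e\<in>C. edge_cost D e)"

text \<open>A minimization program is given by its feasible set and its objective function.\<close>

definition exact_tsp_formulation ::
    "real^'n^'n \<Rightarrow> 'x set \<Rightarrow> ('x \<Rightarrow> real) \<Rightarrow> bool" where
  "exact_tsp_formulation D F obj \<longleftrightarrow>
     (\<forall>C. hamiltonian_cycle complete_graph_edges C \<longrightarrow>
        (\<exists>X\<in>F. obj X = cycle_cost D C)) \<and>
     (\<forall>X\<in>F. \<exists>C. hamiltonian_cycle complete_graph_edges C \<and>
        cycle_cost D C = obj X)"

text \<open>The variables are \<open>X 1, \<dots>, X r\<close>; the values of \<open>X\<close> at other
  indices are irrelevant. In the theorem \<open>n\<close> is the order of the matrices.\<close>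

definition misdp_feasible :: "nat \<Rightarrow> nat \<Rightarrow> (nat \<Rightarrow> real^'n^'n) set" where
  "misdp_feasible n r = {X.
     identity_matrix + (\<Sum>i = 1..r. X i) = all_ones_matrix \<and>
     (\<forall>j\<in>{1..r}. psd (identity_matrix +
        (\<Sum>i = 1..r. cos (2 * real i * real j * pi / real n) *\<^sub>R X i))) \<and>
     symmetric_matrix (X 1) \<and> binary_matrix (X 1) \<and>
     (\<forall>i\<in>{2..r}. nonneg_matrix (X i) \<and> symmetric_matrix (X i))}"

definition misdp_objective ::
    "real^'n^'n \<Rightarrow> (nat \<Rightarrow> real^'n^'n) \<Rightarrow> real" where
  "misdp_objective D X = 1 / 2 * trace_inner D (X 1)"

end

theory Submission
  imports Defs
begin

text \<open>A Hamiltonian cycle gives the feasible point whose \<open>X i\<close> is the distance-\<open>i\<close> matrix of the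
  cycle: the constraint matrices become \<open>cos (t a - t b)\<close>, which is a sum of two rank-one forms.
  Conversely, write \<open>q i\<close> for the quadratic form of \<open>X i\<close> and \<open>y j\<close> for that of the \<open>j\<close>-th constraint
  matrix. Discrete Fourier inversion expresses \<open>q 1\<close> through the nonnegative \<open>y j\<close> and yields
  \<open>q 1 (x) \<le> 2 * cos (2 * pi / n) * (x \<bullet> x)\<close> for \<open>x\<close> orthogonal to the all-ones vector, while the
  all-ones vector itself is an eigenvector of \<open>X 1\<close> for the eigenvalue 2. Hence \<open>X 1\<close> is the adjacency
  matrix of a 2-regular graph with a spectral gap, that is, of a connected one, and a longest path
  in it closes up to a Hamiltonian cycle.\<close>

section \<open>Cosine sums\<close>

text \<open>The Dirichlet kernel, kept multiplied by \<open>2 * sin (x / 2)\<close> to avoid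
  division: each product \<open>2 * sin (x / 2) * cos (j * x)\<close> is a difference of sines at
  half-integer multiples of \<open>x\<close>, so the sum telescopes.\<close>

lemma sum_cos_multiples:
  fixes x :: real
  shows "2 * sin (x / 2) * (\<Sum>j = 1..r. cos (real j * x)) = sin ((real r + 1 / 2) * x) - sin (x / 2)"
proof (induction r)
  case 0
  then show ?case by (simp add: field_simps)
next
  case (Suc r)
  have "2 * sin (x / 2) * cos (real (Suc r) * x)
      = sin (x / 2 + real (Suc r) * x) + sin (x / 2 - real (Suc r) * x)"
    by (simp add: sin_add sin_diff)
  also have "\<dots> = sin ((real (Suc r) + 1 / 2) * x) - sin ((real r + 1 / 2) * x)"
  proof -
    have "x / 2 + real (Suc r) * x = (real (Suc r) + 1 / 2) * x"
      and "x / 2 - real (Suc r) * x = - ((real r + 1 / 2) * x)"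
      by (simp_all add: algebra_simps)
    then show ?thesis by (simp only: sin_minus)
  qed
  finally show ?case using Suc by (simp add: distrib_left)
qed

text \<open>At \<open>x = 2 * m * pi / n\<close> the kernel loses its first sine, because
  \<open>r + 1 / 2 = n / 2\<close> makes that angle \<open>m * pi\<close>, while
  \<open>sin (x / 2)\<close> is nonzero because \<open>n\<close> does not divide \<open>m\<close>.
  An integer \<open>m\<close> admits differences of indices.\<close>

lemma sum_cos_nonzero:
  fixes m :: int
  assumes "n = 2 * r + 1" and "\<not> int n dvd m"
  shows "2 * (\<Sum>j = 1..r. cos (2 * real_of_int m * real j * pi / real n)) = -1"
proof -
  define x where "x = 2 * real_of_int m * pi / real n"
  have n: "real n = 2 * real r + 1" using assms(1) by simp
  have "sin (x / 2) \<noteq> 0"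
  proof
    assume "sin (x / 2) = 0"
    then obtain k :: int where "x / 2 = of_int k * pi"
      by (auto simp: sin_zero_iff_int2)
    moreover have "n \<noteq> 0" using assms(1) by simp
    ultimately have "real_of_int m * pi = of_int k * real n * pi"
      unfolding x_def by (simp add: divide_eq_eq)
    then have "real_of_int m = of_int k * real n" by simp
    then have "m = k * int n"
      by (metis of_int_eq_iff of_int_mult of_int_of_nat_eq)
    then show False using assms(2) by simp
  qed
  moreover have "sin ((real r + 1 / 2) * x) = 0"
  proof -
    have "(real r + 1 / 2) * x = of_int m * pi"
      unfolding x_def n by (simp add: field_simps)
    then show ?thesis by (simp add: sin_zero_iff_int2)
  qed
  ultimately have "sin (x / 2) * (2 * (\<Sum>j = 1..r. cos (real j * x))) = sin (x / 2) * (-1)"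
    using sum_cos_multiples[of x r] by (simp add: mult.assoc mult.left_commute)
  then have "2 * (\<Sum>j = 1..r. cos (real j * x)) = -1"
    using \<open>sin (x / 2) \<noteq> 0\<close> by (simp only: mult_cancel_left) simp
  moreover have "real j * x = 2 * real_of_int m * real j * pi / real n" for j
    by (simp add: x_def)
  ultimately show ?thesis by simp
qed

text \<open>The product formula leaves the frequencies \<open>k + i\<close> and
  \<open>k - i\<close>. The first lies between 2 and \<open>n - 1\<close>, so only
  \<open>k - i = 0\<close> can be a multiple of \<open>n\<close>. The leading 1 is the term
  \<open>j = 0\<close>; the factor 2 reflects the symmetry between \<open>j\<close> and
  \<open>n - j\<close>.\<close>

lemma cosine_orthogonality:
  assumes n: "n = 2 * r + 1" and k: "k \<in> {1..r}" and i: "i \<in> {1..r}"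
  shows "1 + 2 * (\<Sum>j = 1..r. cos (2 * real k * real j * pi / real n) * cos (2 * real i * real j * pi / real n))
    = (if i = k then real n / 2 else 0)"
proof -
  let ?c = "\<lambda>m::int. \<Sum>j = 1..r. cos (2 * real_of_int m * real j * pi / real n)"
  have "2 * (cos (2 * real k * real j * pi / real n) * cos (2 * real i * real j * pi / real n))
      = cos (2 * real_of_int (int k + int i) * real j * pi / real n)
        + cos (2 * real_of_int (int k - int i) * real j * pi / real n)" for j
  proof -
    let ?a = "2 * real k * real j * pi / real n" and ?b = "2 * real i * real j * pi / real n"
    have "2 * (cos ?a * cos ?b) = cos (?a + ?b) + cos (?a - ?b)"
      by (simp add: cos_add cos_diff)
    moreover have "?a + ?b = 2 * real_of_int (int k + int i) * real j * pi / real n"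
      by (simp add: add_divide_distrib algebra_simps)
    moreover have "?a - ?b = 2 * real_of_int (int k - int i) * real j * pi / real n"
      by (simp add: diff_divide_distrib algebra_simps)
    ultimately show ?thesis by simp
  qed
  then have eq: "2 * (\<Sum>j = 1..r. cos (2 * real k * real j * pi / real n) * cos (2 * real i * real j * pi / real n))
      = ?c (int k + int i) + ?c (int k - int i)"
    by (simp add: sum_distrib_left sum.distrib del: of_int_add of_int_diff)
  have "\<not> int n dvd int k + int i"
    using n k i by (auto dest: zdvd_imp_le)
  then have plus: "2 * ?c (int k + int i) = -1"
    by (rule sum_cos_nonzero[OF n])
  show ?thesis
  proof (cases "i = k")
    case True
    then have "?c (int k - int i) = real r" by simp
    then show ?thesis using eq plus n True by simp
  next
    case False
    have "\<not> int n dvd int k - int i"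
    proof
      assume "int n dvd int k - int i"
      then have "\<bar>int n\<bar> \<le> \<bar>int k - int i\<bar>"
        using False by (intro dvd_imp_le_int) auto
      then show False using n k i by auto
    qed
    then have "2 * ?c (int k - int i) = -1"
      by (rule sum_cos_nonzero[OF n])
    then show ?thesis using eq plus False by simp
  qed
qed

text \<open>The inverse of the cosine transform taking the coefficients \<open>q0\<close>,
  \<open>q i\<close> to the values \<open>y j\<close>. It will be applied with \<open>q0\<close> the
  form of the identity matrix and \<open>q i\<close> that of \<open>X i\<close>.\<close>

lemma cosine_inversion:
  fixes q0 :: real and q y :: "nat \<Rightarrow> real"
  assumes n: "n = 2 * r + 1"
    and y: "\<And>j. y j = q0 + (\<Sum>i = 1..r. cos (2 * real i * real j * pi / real n) * q i)"
  shows "y 0 + 2 * (\<Sum>j = 1..r. y j) = real n * q0"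
    and "k \<in> {1..r} \<Longrightarrow>
      y 0 + 2 * (\<Sum>j = 1..r. cos (2 * real k * real j * pi / real n) * y j) = real n / 2 * q k"
proof -
  let ?c = "\<lambda>i j. cos (2 * real i * real j * pi / real n)"
  have s: "2 * (\<Sum>j = 1..r. ?c i j) = -1" if "i \<in> {1..r}" for i
  proof -
    have "\<not> int n dvd int i" using n that by (auto dest: zdvd_imp_le)
    from sum_cos_nonzero[OF n this] show ?thesis by simp
  qed
  have y0: "y 0 = q0 + (\<Sum>i = 1..r. q i)" by (simp add: y)
  \<comment> \<open>Free weights \<open>w\<close> serve both claims: constant 1 for
    \<open>q0\<close>, the \<open>k\<close>-th cosine for \<open>q k\<close>.\<close>
  have swap: "(\<Sum>j = 1..r. w j * y j)
      = (\<Sum>j = 1..r. w j) * q0 + (\<Sum>i = 1..r. (\<Sum>j = 1..r. w j * ?c i j) * q i)" for w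
  proof -
    have "(\<Sum>j = 1..r. w j * y j)
        = (\<Sum>j = 1..r. w j) * q0 + (\<Sum>j = 1..r. \<Sum>i = 1..r. w j * ?c i j * q i)"
      by (simp add: y distrib_left sum.distrib sum_distrib_left sum_distrib_right mult.assoc)
    also have "(\<Sum>j = 1..r. \<Sum>i = 1..r. w j * ?c i j * q i)
        = (\<Sum>i = 1..r. (\<Sum>j = 1..r. w j * ?c i j) * q i)"
      by (subst sum.swap) (simp add: sum_distrib_right)
    finally show ?thesis .
  qed
  have "2 * (\<Sum>j = 1..r. y j) = 2 * real r * q0 + (\<Sum>i = 1..r. 2 * (\<Sum>j = 1..r. ?c i j) * q i)"
    using swap[of "\<lambda>_. 1"]
    by (simp add: distrib_left sum_distrib_left[of 2 "\<lambda>i. _ i * q i"] mult.assoc)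
  also have "(\<Sum>i = 1..r. 2 * (\<Sum>j = 1..r. ?c i j) * q i) = (\<Sum>i = 1..r. - q i)"
    by (rule sum.cong) (use s in auto)
  finally show "y 0 + 2 * (\<Sum>j = 1..r. y j) = real n * q0"
    using n by (simp add: y0 sum_negf algebra_simps)
  assume k: "k \<in> {1..r}"
  have "y 0 + 2 * (\<Sum>j = 1..r. ?c k j * y j)
      = (1 + 2 * (\<Sum>j = 1..r. ?c k j)) * q0
        + (\<Sum>i = 1..r. (1 + 2 * (\<Sum>j = 1..r. ?c k j * ?c i j)) * q i)"
    unfolding swap y0
    by (simp add: distrib_left distrib_right sum.distrib mult.assoc
        sum_distrib_left[of 2 "\<lambda>i. _ i * q i"])
  also have "\<dots> = (\<Sum>i = 1..r. (if i = k then real n / 2 else 0) * q i)"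
    using s[OF k] cosine_orthogonality[OF n k] by simp
  also have "\<dots> = (\<Sum>i = 1..r. if i = k then real n / 2 * q i else 0)"
    by (rule sum.cong) auto
  also have "\<dots> = real n / 2 * q k"
    using k by simp
  finally show "y 0 + 2 * (\<Sum>j = 1..r. ?c k j * y j) = real n / 2 * q k" .
qed

section \<open>Connected 2-regular graphs\<close>

text \<open>By maximality, all neighbours of the first vertex of a longest path lie on the path. The
  one other than the second vertex must be the last vertex, since an inner one would get a third
  neighbour. The resulting cycle uses up all degrees, so its vertex set is closed under adjacency
  and \<open>conn\<close> makes it everything.\<close>

lemma connected_two_regular_cycle:
  fixes adj :: "'v::finite \<Rightarrow> 'v \<Rightarrow> bool"
  assumes sym: "\<And>u v. adj u v \<Longrightarrow> adj v u"
    and irrefl: "\<And>u. \<not> adj u u"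
    and deg: "\<And>u. card {v. adj u v} = 2"
    and conn: "\<And>S. S \<noteq> {} \<Longrightarrow> (\<And>u v. u \<in> S \<Longrightarrow> adj u v \<Longrightarrow> v \<in> S) \<Longrightarrow> S = UNIV"
  shows "\<exists>vs. distinct vs \<and> set vs = UNIV \<and> 3 \<le> length vs
    \<and> closed_walk_edges vs = {{u, v} | u v. adj u v}"
proof -
  define path where "path vs \<longleftrightarrow> distinct vs \<and> vs \<noteq> []
    \<and> (\<forall>k. Suc k < length vs \<longrightarrow> adj (vs ! k) (vs ! Suc k))" for vs
  have "path [undefined]" by (simp add: path_def)
  moreover have "length vs < Suc CARD('v)" if "path vs" for vs
    using that card_mono[of UNIV "set vs"] by (simp add: path_def distinct_card)
  ultimately obtain vs where vs: "path vs" and longest: "\<And>ws. path ws \<Longrightarrow> length ws \<le> length vs"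
    using ex_has_greatest_nat[of path "[undefined]" length "Suc CARD('v)"] by (meson less_imp_le)
  define L where "L = length vs"
  have dist: "distinct vs" and L0: "L > 0"
    and step: "\<And>k. Suc k < L \<Longrightarrow> adj (vs ! k) (vs ! Suc k)"
    using vs by (auto simp: path_def L_def)
  have inj: "vs ! i = vs ! j \<longleftrightarrow> i = j" if "i < L" "j < L" for i j
    using dist that by (simp add: L_def nth_eq_iff_index_eq)
  have front: "w \<in> set vs" if w: "adj (vs ! 0) w" for w
  proof (rule ccontr)
    assume "w \<notin> set vs"
    then have "path (w # vs)"
      using dist L0 step sym[OF w] by (auto simp: path_def L_def nth_Cons split: nat.splits)
    from longest[OF this] show False by simp
  qed
  have two: "\<exists>w. adj u w \<and> w \<noteq> v" for u v
  proof (rule ccontr)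
    assume "\<not> ?thesis"
    then have "card {w. adj u w} \<le> card {v}" by (intro card_mono) auto
    then show False using deg[of u] by simp
  qed
  have nbrs: "w = a \<or> w = b" if "adj u a" "adj u b" "a \<noteq> b" "adj u w" for u a b w
  proof -
    have "{a, b} = {v. adj u v}"
      using that deg[of u] by (intro card_seteq) auto
    then show ?thesis using that(4) by auto
  qed
  \<comment> \<open>Should the path have a single vertex, \<open>vs ! 1\<close> is an unspecified
    value; this is harmless, as \<open>two\<close> excludes an arbitrary vertex.\<close>
  obtain w where w: "adj (vs ! 0) w" "w \<noteq> vs ! 1" using two by blast
  obtain m where m: "m < L" "w = vs ! m"
    using front[OF w(1)] by (auto simp: in_set_conv_nth L_def)
  have m2: "m \<ge> 2"
  proof -
    have "m \<noteq> 0" using w(1) irrefl m(2) by metis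
    moreover have "m \<noteq> 1" using w(2) m(2) by metis
    ultimately show ?thesis by simp
  qed
  have mL: "Suc m = L"
  proof (rule ccontr)
    assume "Suc m \<noteq> L"
    then have sm: "Suc m < L" using m(1) by simp
    have "adj (vs ! m) (vs ! (m - 1))" using sym[OF step[of "m - 1"]] m2 m(1) by simp
    moreover have "adj (vs ! m) (vs ! Suc m)" using step[OF sm] .
    moreover have "vs ! (m - 1) \<noteq> vs ! Suc m" using inj sm by simp
    moreover have "adj (vs ! m) (vs ! 0)" using sym[OF w(1)] m(2) by simp
    ultimately have "vs ! 0 = vs ! (m - 1) \<or> vs ! 0 = vs ! Suc m" by (rule nbrs)
    then show False using inj sm m2 by auto
  qed
  have L3: "L \<ge> 3" using m2 mL by simp
  \<comment> \<open>Successor and predecessor along the closed path; \<open>L \<ge> 3\<close> keeps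
    them distinct, so they give both neighbours of a vertex.\<close>
  define nx where "nx i = Suc i mod L" for i
  define pv where "pv i = (if i = 0 then L - 1 else i - 1)" for i
  have nx_eq: "nx i = (if Suc i = L then 0 else Suc i)" if "i < L" for i
    using that by (auto simp: nx_def)
  have nxL: "nx i < L" and pvL: "pv i < L" and nxpv: "nx (pv i) = i" and ne: "pv i \<noteq> nx i"
    if "i < L" for i
    using that L3 nx_eq by (auto simp: pv_def)
  have cyc: "adj (vs ! i) (vs ! nx i)" if "i < L" for i
  proof (cases "Suc i = L")
    case True
    then have "i = m" using mL by simp
    then show ?thesis using True sym[OF w(1)] m(2) nx_eq[OF that] by simp
  next
    case False
    then show ?thesis using that step[of i] nx_eq[OF that] by simp
  qed
  have around: "v = vs ! nx i \<or> v = vs ! pv i" if i: "i < L" and v: "adj (vs ! i) v" for i v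
  proof (rule nbrs[OF _ _ _ v])
    show "adj (vs ! i) (vs ! nx i)" by (rule cyc[OF i])
    show "adj (vs ! i) (vs ! pv i)" using sym[OF cyc[OF pvL[OF i]]] nxpv[OF i] by simp
    show "vs ! nx i \<noteq> vs ! pv i" using inj[OF nxL pvL] i ne[OF i] by simp
  qed
  have "set vs = UNIV"
  proof (rule conn)
    show "set vs \<noteq> {}" using L0 by (auto simp: L_def)
    fix u v assume "u \<in> set vs" "adj u v"
    then obtain i where "i < L" "u = vs ! i" by (auto simp: in_set_conv_nth L_def)
    then show "v \<in> set vs" using around[of i v] \<open>adj u v\<close> nxL pvL by (auto simp: L_def)
  qed
  moreover have "closed_walk_edges vs = {{u, v} | u v. adj u v}"
  proof
    show "closed_walk_edges vs \<subseteq> {{u, v} | u v. adj u v}"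
      using cyc by (fastforce simp: closed_walk_edges_def nx_def L_def)
    show "{{u, v} | u v. adj u v} \<subseteq> closed_walk_edges vs"
    proof clarify
      fix u v assume uv: "adj u v"
      have "u \<in> set vs" using \<open>set vs = UNIV\<close> by simp
      then obtain i where i: "i < L" "u = vs ! i" by (auto simp: in_set_conv_nth L_def)
      have walk: "{vs ! k, vs ! nx k} \<in> closed_walk_edges vs" if "k < L" for k
        using that by (auto simp: closed_walk_edges_def nx_def L_def)
      from around[OF i(1)] uv i(2) consider "v = vs ! nx i" | "v = vs ! pv i" by blast
      then show "{u, v} \<in> closed_walk_edges vs"
      proof cases
        case 1
        then show ?thesis using walk[OF i(1)] i(2) by simp
      next
        case 2
        then show ?thesis using walk[OF pvL[OF i(1)]] nxpv[OF i(1)] i(2)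
          by (simp add: insert_commute)
      qed
    qed
  qed
  ultimately show ?thesis using dist L3 by (auto simp: L_def)
qed

section \<open>Cost of a cycle\<close>

lemma trace_inner_eq_sum:
  "trace_inner X Y = (\<Sum>i\<in>UNIV. \<Sum>j\<in>UNIV. X $ i $ j * Y $ i $ j)"
  unfolding trace_inner_def trace_def matrix_matrix_mult_def transpose_def
  by (simp, rule sum.swap)

text \<open>Every edge comes from exactly two ordered pairs, as members of
  \<open>complete_graph_edges\<close> are not loops; this cancels the factor
  \<open>1 / 2\<close>.\<close>

lemma trace_inner_adjacency:
  fixes D A :: "real^'n^'n"
  assumes D: "symmetric_matrix D" and C: "C \<subseteq> complete_graph_edges"
    and A: "\<And>i j. A $ i $ j = (if {i, j} \<in> C then 1 else 0)"
  shows "1 / 2 * trace_inner D A = cycle_cost D C"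
proof -
  let ?f = "\<lambda>(i::'n, j). {i, j}"
  let ?S = "{p. ?f p \<in> C}"
  have "trace_inner D A = (\<Sum>(i, j)\<in>UNIV. if {i, j} \<in> C then edge_cost D {i, j} else 0)"
    by (simp add: trace_inner_eq_sum A edge_cost_eq[OF D] sum.cartesian_product if_distrib
        flip: UNIV_Times_UNIV cong: if_cong)
  also have "\<dots> = (\<Sum>p\<in>UNIV. if ?f p \<in> C then edge_cost D (?f p) else 0)"
    by (rule sum.cong) auto
  also have "\<dots> = (\<Sum>p\<in>?S. edge_cost D (?f p))"
    by (simp add: sum.If_cases)
  also have "\<dots> = (\<Sum>e\<in>?f ` ?S. \<Sum>p | p \<in> ?S \<and> ?f p = e. edge_cost D (?f p))"
    by (rule sum.image_gen) simp
  also have "?f ` ?S = C"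
    using C by (auto simp: complete_graph_edges_def image_iff)
  also have "(\<Sum>e\<in>C. \<Sum>p | p \<in> ?S \<and> ?f p = e. edge_cost D (?f p)) = (\<Sum>e\<in>C. 2 * edge_cost D e)"
  proof (rule sum.cong[OF refl])
    fix e assume e: "e \<in> C"
    then obtain u v where uv: "e = {u, v}" "u \<noteq> v"
      using C by (auto simp: complete_graph_edges_def)
    have "p \<in> ?S \<and> ?f p = e \<longleftrightarrow> p = (u, v) \<or> p = (v, u)" for p
    proof -
      have "p \<in> ?S \<and> ?f p = e \<longleftrightarrow> ?f p = {u, v}"
        using e unfolding uv(1) by (auto simp only: mem_Collect_eq)
      also have "\<dots> \<longleftrightarrow> p = (u, v) \<or> p = (v, u)"
        by (cases p) (simp add: doubleton_eq_iff)
      finally show ?thesis .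
    qed
    then have fibre: "{p. p \<in> ?S \<and> ?f p = e} = {(u, v), (v, u)}"
      by (simp only: set_eq_iff mem_Collect_eq insert_iff empty_iff simp_thms)
    have "(\<Sum>p | p \<in> ?S \<and> ?f p = e. edge_cost D (?f p)) = (\<Sum>p | p \<in> ?S \<and> ?f p = e. edge_cost D e)"
      by (rule sum.cong) auto
    also have "\<dots> = 2 * edge_cost D e"
      unfolding fibre using uv(2) by simp
    finally show "(\<Sum>p | p \<in> ?S \<and> ?f p = e. edge_cost D (?f p)) = 2 * edge_cost D e" .
  qed
  finally show ?thesis by (simp add: cycle_cost_def sum_distrib_left)
qed

section \<open>Distance matrices of a cycle\<close>

lemma symmetric_matrix_iff: "symmetric_matrix A \<longleftrightarrow> (\<forall>i j. A $ i $ j = A $ j $ i)"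
  by (auto simp: symmetric_matrix_def transpose_def vec_eq_iff)

lemma inner_matrix_vector_eq_sum:
  "x \<bullet> (A *v x) = (\<Sum>a\<in>UNIV. \<Sum>b\<in>UNIV. x $ a * A $ a $ b * x $ b)"
  by (simp add: inner_vec_def matrix_vector_mult_def sum_distrib_left mult.assoc)

text \<open>This is the Gram matrix of the plane unit vectors
  \<open>(cos (t a), sin (t a))\<close>.\<close>

lemma psd_cos_diff: "psd (\<chi> a b. cos (t a - t b))"
proof -
  have "0 \<le> x \<bullet> ((\<chi> a b. cos (t a - t b)) *v x)" for x
  proof -
    have "x \<bullet> ((\<chi> a b. cos (t a - t b)) *v x)
        = (\<Sum>a\<in>UNIV. x $ a * cos (t a))\<^sup>2 + (\<Sum>a\<in>UNIV. x $ a * sin (t a))\<^sup>2"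
      by (simp add: inner_matrix_vector_eq_sum cos_diff power2_eq_square sum_product
          sum.distrib[symmetric] algebra_simps)
    then show ?thesis by simp
  qed
  moreover have "cos (t a - t b) = cos (t b - t a)" for a b
    by (metis cos_minus minus_diff_eq)
  ultimately show ?thesis by (simp add: psd_def symmetric_matrix_iff)
qed

section \<open>Cyclic distance between list positions\<close>

definition pos_dist :: "nat \<Rightarrow> nat \<Rightarrow> nat" where
  "pos_dist i j = (if i \<le> j then j - i else i - j)"

definition cycle_dist :: "nat \<Rightarrow> nat \<Rightarrow> nat \<Rightarrow> nat" where
  "cycle_dist n i j = min (pos_dist i j) (n - pos_dist i j)"

lemma cycle_dist_commute: "cycle_dist n i j = cycle_dist n j i"
  by (simp add: cycle_dist_def pos_dist_def)

lemma cycle_dist_eq_0_iff: "i < n \<Longrightarrow> j < n \<Longrightarrow> cycle_dist n i j = 0 \<longleftrightarrow> i = j"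
  by (auto simp: cycle_dist_def pos_dist_def min_def)

lemma cycle_dist_le: "cycle_dist (2 * r + 1) i j \<le> r"
  by (simp add: cycle_dist_def min_def) linarith

lemma cycle_dist_eq_1_iff:
  assumes "3 \<le> n" "i < n" "j < n"
  shows "cycle_dist n i j = 1 \<longleftrightarrow> j = Suc i mod n \<or> i = Suc j mod n"
proof -
  have "Suc i mod n = (if Suc i = n then 0 else Suc i)"
    and "Suc j mod n = (if Suc j = n then 0 else Suc j)"
    using assms by auto
  then show ?thesis using assms
    by (auto simp: cycle_dist_def pos_dist_def min_def split: if_splits)
qed

text \<open>Cosine is even and \<open>k\<close> is an integer, so replacing the signed difference
  \<open>i - j\<close> by its absolute value \<open>d\<close>, or \<open>d\<close> by
  \<open>n - d\<close>, changes nothing. The right-hand side has the form needed for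
  \<open>psd_cos_diff\<close>.\<close>

lemma cos_cycle_dist:
  assumes "i < n" "j < n"
  shows "cos (2 * real (cycle_dist n i j) * real k * pi / real n)
    = cos (2 * real i * real k * pi / real n - 2 * real j * real k * pi / real n)"
proof -
  let ?d = "pos_dist i j"
  let ?t = "2 * real k * pi / real n"
  have d: "?d < n" using assms by (auto simp: pos_dist_def)
  have "cos (2 * real ?d * real k * pi / real n) = cos (real ?d * ?t)"
    by (simp add: mult.assoc mult.left_commute)
  also have "\<dots> = cos ((real i - real j) * ?t)"
  proof (cases "i \<le> j")
    case True
    then have "real ?d = - (real i - real j)"
      by (simp add: pos_dist_def of_nat_diff)
    then show ?thesis by (simp only: mult_minus_left cos_minus)
  next
    case False
    then show ?thesis by (simp add: pos_dist_def of_nat_diff)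
  qed
  also have "(real i - real j) * ?t = 2 * real i * real k * pi / real n - 2 * real j * real k * pi / real n"
    by (simp add: algebra_simps diff_divide_distrib)
  finally have *: "cos (2 * real ?d * real k * pi / real n)
    = cos (2 * real i * real k * pi / real n - 2 * real j * real k * pi / real n)" .
  have "2 * real (n - ?d) * real k * pi / real n
      = of_int (int k) * (2 * pi) - 2 * real ?d * real k * pi / real n"
    using d by (simp add: of_nat_diff field_simps)
  then have "cos (2 * real (n - ?d) * real k * pi / real n) = cos (2 * real ?d * real k * pi / real n)"
    using cos_int_2pin[of "int k"] sin_int_2pin[of "int k"] by (simp only: cos_diff) (simp add: mult.commute)
  with * show ?thesis by (simp add: cycle_dist_def min_def)
qed

lemma hamiltonian_cycle_feasible:
  fixes D :: "real^'n^'n"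
  assumes n: "n = CARD('n)" "n = 2 * r + 1"
    and D: "symmetric_matrix D"
    and C: "hamiltonian_cycle complete_graph_edges C"
  shows "\<exists>X\<in>misdp_feasible n r. misdp_objective D X = cycle_cost D C"
proof -
  obtain vs :: "'n list" where vs: "distinct vs" "set vs = UNIV" "3 \<le> length vs" "C = closed_walk_edges vs"
    and CE: "C \<subseteq> complete_graph_edges"
    using C by (auto simp: hamiltonian_cycle_def)
  have len: "length vs = n" using distinct_card[OF vs(1)] vs(2) n(1) by simp
  have "\<forall>a. \<exists>k. k < n \<and> vs ! k = a"
    using vs(2) len by (metis UNIV_I in_set_conv_nth)
  \<comment> \<open>\<open>p\<close> gives the position of a vertex in the cyclic order.\<close>
  from choice[OF this] obtain p where p: "\<And>a. p a < n" "\<And>a. vs ! p a = a" by blast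
  have pk: "p (vs ! k) = k" if "k < n" for k
    using nth_eq_iff_index_eq[OF vs(1), of "p (vs ! k)" k] len p that by simp
  have p_inj: "p a = p b \<longleftrightarrow> a = b" for a b using p(2) by metis
  define X :: "nat \<Rightarrow> real^'n^'n" where
    "X i = (\<chi> a b. if cycle_dist n (p a) (p b) = i then 1 else 0)" for i
  \<comment> \<open>The identity is the distance-0 matrix, hence \<open>c 0 = 1\<close>. Constant
    \<open>c\<close> gives the all-ones equation, cosine \<open>c\<close> the semidefinite
    constraints.\<close>
  have sum_X: "identity_matrix + (\<Sum>i = 1..r. c i *\<^sub>R X i) = (\<chi> a b. c (cycle_dist n (p a) (p b)))"
    if "c 0 = 1" for c
  proof -
    have "(if a = b then 1 else 0) + (\<Sum>i = 1..r. if cycle_dist n (p a) (p b) = i then c i else 0)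
      = c (cycle_dist n (p a) (p b))" for a b
    proof (cases "a = b")
      case True
      then have "cycle_dist n (p a) (p b) = 0" by (simp add: cycle_dist_eq_0_iff p)
      then show ?thesis using True that by simp
    next
      case False
      then have "cycle_dist n (p a) (p b) \<noteq> 0" by (simp add: cycle_dist_eq_0_iff p p_inj)
      then have "cycle_dist n (p a) (p b) \<in> {1..r}"
        using cycle_dist_le[of r "p a" "p b"] n(2) by simp
      then show ?thesis using False by simp
    qed
    then show ?thesis
      by (simp add: vec_eq_iff X_def identity_matrix_def mat_def if_distrib cong: if_cong)
  qed
  have "X \<in> misdp_feasible n r"
    unfolding misdp_feasible_def
  proof (intro CollectI conjI ballI)
    show "identity_matrix + (\<Sum>i = 1..r. X i) = all_ones_matrix"
      using sum_X[of "\<lambda>_. 1"] by (simp add: all_ones_matrix_def)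
    show "psd (identity_matrix + (\<Sum>i = 1..r. cos (2 * real i * real j * pi / real n) *\<^sub>R X i))" for j
      by (subst sum_X) (simp_all add: cos_cycle_dist p psd_cos_diff)
    show "binary_matrix (X 1)"
      by (simp add: binary_matrix_def X_def)
    show "nonneg_matrix (X i)" for i
      by (simp add: nonneg_matrix_def X_def)
    show "symmetric_matrix (X i)" and "symmetric_matrix (X 1)" for i
      by (simp_all add: symmetric_matrix_iff X_def cycle_dist_commute)
  qed
  moreover have "misdp_objective D X = cycle_cost D C"
    unfolding misdp_objective_def
  proof (rule trace_inner_adjacency[OF D CE])
    fix a b
    have "{a, b} \<in> C \<longleftrightarrow> (\<exists>k<n. {a, b} = {vs ! k, vs ! (Suc k mod n)})"
      by (auto simp: vs(4) closed_walk_edges_def len)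
    also have "\<dots> \<longleftrightarrow> p b = Suc (p a) mod n \<or> p a = Suc (p b) mod n"
    proof -
      have "Suc k mod n < n" for k using n(2) by simp
      then show ?thesis
        using pk p by (metis doubleton_eq_iff)
    qed
    finally show "X 1 $ a $ b = (if {a, b} \<in> C then 1 else 0)"
      using cycle_dist_eq_1_iff[of n "p a" "p b"] p vs(3) len by (simp add: X_def)
  qed
  ultimately show ?thesis by blast
qed

section \<open>Feasible solutions\<close>

lemma linear_quadratic_form:
  fixes x :: "real^'n"
  shows "linear (\<lambda>A. x \<bullet> (A *v x))"
  by (intro linearI)
    (simp_all add: matrix_vector_mult_add_rdistrib inner_add_right flip: scaleR_matrix_vector_assoc)

text \<open>A differentiable function with a minimum at 0 has zero derivative there; a nonzero
  \<open>a\<close> is refuted by an explicit point.\<close>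

lemma linear_coefficient_zero:
  fixes a b :: real
  assumes "\<And>t. 0 \<le> t * a + t\<^sup>2 * b"
  shows "a = 0"
proof (rule ccontr)
  assume a: "a \<noteq> 0"
  \<comment> \<open>Any positive \<open>K > b\<close> works: at \<open>t = - a / K\<close> the
    polynomial equals \<open>a\<^sup>2 / K\<^sup>2 * (b - K)\<close>.\<close>
  define K where "K = \<bar>b\<bar> + 1"
  have K: "K > 0" "b < K" by (auto simp: K_def)
  have "(- a / K) * a + (- a / K)\<^sup>2 * b = a\<^sup>2 / K\<^sup>2 * (b - K)"
    using K by (simp add: field_simps power2_eq_square)
  also have "\<dots> < 0" using a K by (intro mult_pos_neg) auto
  finally show False using assms[of "- a / K"] by simp
qed

context
  fixes X :: "nat \<Rightarrow> real^'n^'n" and n r :: nat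
  assumes n: "n = CARD('n)" "n = 2 * r + 1" "r \<ge> 1"
    and feasible: "X \<in> misdp_feasible n r"
begin

text \<open>Inversion writes \<open>n / 2\<close> times the form of \<open>X 1\<close> as
  \<open>s\<^sup>2\<close> plus a weighted sum of the nonnegative \<open>2 * y j\<close>, whose
  total is \<open>n * (x \<bullet> x) - s\<^sup>2\<close>. The weights
  \<open>cos (2 * j * pi / n)\<close> lie between -1 and \<open>cos (2 * pi / n)\<close>.\<close>

lemma X1_bound:
  fixes x :: "real^'n"
  defines "s \<equiv> (\<Sum>a\<in>UNIV. x $ a)"
  shows "real n / 2 * (x \<bullet> (X 1 *v x)) \<le> s\<^sup>2 + cos (2 * pi / real n) * (real n * (x \<bullet> x) - s\<^sup>2)"
    and "s\<^sup>2 - (real n * (x \<bullet> x) - s\<^sup>2) \<le> real n / 2 * (x \<bullet> (X 1 *v x))"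
proof -
  interpret linear "\<lambda>A::real^'n^'n. x \<bullet> (A *v x)" by (rule linear_quadratic_form)
  let ?c = "\<lambda>i j. cos (2 * real i * real j * pi / real n)"
  define y where "y j = x \<bullet> x + (\<Sum>i = 1..r. ?c i j * (x \<bullet> (X i *v x)))" for j
  have y: "y j = x \<bullet> ((identity_matrix + (\<Sum>i = 1..r. ?c i j *\<^sub>R X i)) *v x)" for j
    unfolding y_def by (simp add: add sum scale identity_matrix_def)
  \<comment> \<open>The value at \<open>j = 0\<close> comes from the linear equation: all cosines
    are 1 there.\<close>
  have "y 0 = x \<bullet> (all_ones_matrix *v x)"
    using feasible by (simp add: y misdp_feasible_def)
  also have "\<dots> = s\<^sup>2"
    by (simp add: inner_matrix_vector_eq_sum all_ones_matrix_def s_def power2_eq_square sum_product)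
  finally have y0: "y 0 = s\<^sup>2" .
  have pos: "0 \<le> y j" if "j \<in> {1..r}" for j
    using feasible that by (auto simp: y misdp_feasible_def psd_def)
  have total: "s\<^sup>2 + 2 * (\<Sum>j = 1..r. y j) = real n * (x \<bullet> x)"
    using cosine_inversion(1)[OF n(2) y_def] y0 by simp
  have first: "s\<^sup>2 + 2 * (\<Sum>j = 1..r. ?c 1 j * y j) = real n / 2 * (x \<bullet> (X 1 *v x))"
    using cosine_inversion(2)[OF n(2) y_def, of 1] y0 n(3) by simp
  have "(\<Sum>j = 1..r. ?c 1 j * y j) \<le> (\<Sum>j = 1..r. cos (2 * pi / real n) * y j)"
  proof (intro sum_mono mult_right_mono pos)
    \<comment> \<open>The angle lies in \<open>[2 * pi / n, pi]\<close>, where cosine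
      decreases.\<close>
    fix j assume j: "j \<in> {1..r}"
    have "2 * real j \<le> real n" using j n(2) by simp
    then have "2 * real j * pi \<le> real n * pi" by (intro mult_right_mono) simp_all
    then have "2 * real j * pi / real n \<le> pi" using n(2) by (simp add: divide_le_eq mult.commute)
    moreover have "2 * pi / real n \<le> 2 * real j * pi / real n"
      using j by (intro divide_right_mono) simp_all
    ultimately show "?c 1 j \<le> cos (2 * pi / real n)"
      by (simp add: cos_monotone_0_pi_le)
  qed
  also have "\<dots> = cos (2 * pi / real n) * (\<Sum>j = 1..r. y j)" by (simp add: sum_distrib_left)
  finally have "2 * (\<Sum>j = 1..r. ?c 1 j * y j) \<le> cos (2 * pi / real n) * (2 * (\<Sum>j = 1..r. y j))"
    by simp
  moreover have eq: "2 * (\<Sum>j = 1..r. y j) = real n * (x \<bullet> x) - s\<^sup>2"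
    using total by simp
  ultimately have "2 * (\<Sum>j = 1..r. ?c 1 j * y j) \<le> cos (2 * pi / real n) * (real n * (x \<bullet> x) - s\<^sup>2)"
    by (simp only:)
  then show "real n / 2 * (x \<bullet> (X 1 *v x)) \<le> s\<^sup>2 + cos (2 * pi / real n) * (real n * (x \<bullet> x) - s\<^sup>2)"
    using first by linarith
  have "(\<Sum>j = 1..r. (-1) * y j) \<le> (\<Sum>j = 1..r. ?c 1 j * y j)"
    by (intro sum_mono mult_right_mono pos) simp_all
  then have "- (\<Sum>j = 1..r. y j) \<le> (\<Sum>j = 1..r. ?c 1 j * y j)"
    by (simp add: sum_negf)
  then show "s\<^sup>2 - (real n * (x \<bullet> x) - s\<^sup>2) \<le> real n / 2 * (x \<bullet> (X 1 *v x))"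
    using first eq by linarith
qed

section \<open>Graph structure of \<open>X 1\<close>: loopless, 2-regular and connected\<close>

lemma X1_symmetric: "X 1 $ a $ b = X 1 $ b $ a"
  using feasible unfolding misdp_feasible_def symmetric_matrix_iff by blast

lemma X1_binary: "X 1 $ a $ b = 0 \<or> X 1 $ a $ b = 1"
  using feasible unfolding misdp_feasible_def binary_matrix_def by blast

text \<open>The linear equation makes the diagonal entries of all \<open>X i\<close> sum to 0, and
  each is nonnegative.\<close>

lemma X1_diagonal: "X 1 $ a $ a = 0"
proof -
  have "(identity_matrix + (\<Sum>i = 1..r. X i)) $ a $ a = 1"
    using feasible by (simp add: misdp_feasible_def all_ones_matrix_def)
  then have "(\<Sum>i = 1..r. X i $ a $ a) = 0"
    by (simp add: identity_matrix_def mat_def)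
  moreover have "0 \<le> X i $ a $ a" if "i \<in> {1..r}" for i
  proof (cases "i = 1")
    case True
    then show ?thesis using X1_binary[of a a] by auto
  next
    case False
    then have "i \<in> {2..r}" using that by auto
    then show ?thesis using feasible by (auto simp: misdp_feasible_def nonneg_matrix_def)
  qed
  ultimately have "\<forall>i\<in>{1..r}. X i $ a $ a = 0"
    by (subst (asm) sum_nonneg_eq_0_iff) auto
  then show ?thesis using n(3) by simp
qed

text \<open>Both bounds of \<open>X1_bound\<close> coincide at the all-ones vector. The gap in the upper bound is a
  nonnegative quadratic form, so its gradient vanishes there.\<close>

lemma X1_row_sum: "(\<Sum>b\<in>UNIV. X 1 $ a $ b) = 2"
proof -
  let ?c = "cos (2 * pi / real n)"
  define e :: "real^'n" where "e = axis a 1"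
  define u :: "real^'n" where "u = (\<chi> i. 1)"
  define d where "d = (\<Sum>b\<in>UNIV. X 1 $ a $ b)"
  have sum_u: "(\<Sum>i\<in>UNIV. u $ i) = real n" and uu: "u \<bullet> u = real n"
    by (simp_all add: u_def n(1) inner_vec_def)
  have sum_e: "(\<Sum>i\<in>UNIV. e $ i) = 1" and ee: "e \<bullet> e = 1" and ue: "u \<bullet> e = 1"
    by (simp_all add: e_def axis_def u_def inner_vec_def if_distrib cong: if_cong)
  have eXu: "e \<bullet> (X 1 *v u) = d"
    by (simp add: e_def inner_axis' u_def matrix_vector_mult_def d_def)
  have "u \<bullet> (X 1 *v e) = (\<Sum>i\<in>UNIV. X 1 $ i $ a)"
    by (simp add: e_def matrix_vector_mult_basis column_def u_def inner_vec_def)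
  also have "\<dots> = d" unfolding d_def by (rule sum.cong[OF refl X1_symmetric])
  finally have uXe: "u \<bullet> (X 1 *v e) = d" .
  have eXe: "e \<bullet> (X 1 *v e) = 0"
    by (simp add: e_def matrix_vector_mult_basis column_def inner_axis' X1_diagonal del: One_nat_def)
  have n0: "real n > 0" using n(2) by simp
  have uXu: "real n / 2 * (u \<bullet> (X 1 *v u)) = (real n)\<^sup>2"
    using X1_bound[of u] by (simp only: sum_u uu) (auto simp: power2_eq_square)
  \<comment> \<open>This is the gap in the upper bound at \<open>u + t *\<^sub>R e\<close>. It has
    no constant term because the bound is tight at \<open>u\<close>, and its linear coefficient
    vanishes exactly when \<open>d = 2\<close>.\<close>
  have "0 \<le> t * (2 * real n - real n * d) + t\<^sup>2 * (1 + ?c * (real n - 1))" for t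
  proof -
    have s: "(\<Sum>i\<in>UNIV. (u + t *\<^sub>R e) $ i) = real n + t"
      using sum_u sum_e by (simp add: sum.distrib flip: sum_distrib_left)
    have "(u + t *\<^sub>R e) \<bullet> (u + t *\<^sub>R e) = real n + 2 * t + t\<^sup>2"
      by (simp add: inner_add_left inner_add_right uu ee ue inner_commute[of e u] power2_eq_square algebra_simps)
    moreover have "(u + t *\<^sub>R e) \<bullet> (X 1 *v (u + t *\<^sub>R e)) = u \<bullet> (X 1 *v u) + 2 * t * d"
      by (simp add: matrix_vector_right_distrib matrix_vector_mult_scaleR inner_add_left inner_add_right
          eXu uXe eXe del: One_nat_def)
    ultimately have "real n / 2 * (u \<bullet> (X 1 *v u) + 2 * t * d)
        \<le> (real n + t)\<^sup>2 + ?c * (real n * (real n + 2 * t + t\<^sup>2) - (real n + t)\<^sup>2)"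
      using X1_bound(1)[of "u + t *\<^sub>R e"] by (simp only: s)
    moreover have "real n / 2 * (u \<bullet> (X 1 *v u) + 2 * t * d) = (real n)\<^sup>2 + t * (real n * d)"
      using uXu by (simp add: algebra_simps)
    moreover have "real n * (real n + 2 * t + t\<^sup>2) - (real n + t)\<^sup>2 = t\<^sup>2 * (real n - 1)"
      by (simp add: power2_eq_square algebra_simps)
    moreover have "(real n + t)\<^sup>2 = (real n)\<^sup>2 + 2 * t * real n + t\<^sup>2"
      by (simp add: power2_eq_square algebra_simps)
    ultimately have "(real n)\<^sup>2 + t * (real n * d)
        \<le> (real n)\<^sup>2 + 2 * t * real n + t\<^sup>2 + ?c * (t\<^sup>2 * (real n - 1))"
      by (simp only:)
    then show ?thesis by (simp add: algebra_simps)
  qed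
  then have "2 * real n - real n * d = 0" by (rule linear_coefficient_zero)
  then show ?thesis using n0 by (simp add: d_def)
qed

lemma X1_degree: "card {b. X 1 $ a $ b = 1} = 2"
proof -
  have "(\<Sum>b\<in>UNIV. X 1 $ a $ b) = (\<Sum>b\<in>UNIV. if X 1 $ a $ b = 1 then 1 else 0)"
    by (rule sum.cong) (use X1_binary in auto)
  then have "real (card {b. X 1 $ a $ b = 1}) = 2"
    using X1_row_sum[of a] by (simp add: sum.If_cases)
  then show ?thesis by simp
qed

text \<open>On vectors orthogonal to the all-ones vector the form of \<open>X 1\<close> is at most \<open>2 * cos (2 * pi / n) < 2\<close> times the squared norm, so
  the eigenvalue 2 of the 2-regular graph is simple.\<close>

lemma X1_connected:
  assumes "S \<noteq> {}" and closed: "\<And>a b. a \<in> S \<Longrightarrow> X 1 $ a $ b = 1 \<Longrightarrow> b \<in> S"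
  shows "S = UNIV"
proof -
  let ?c = "cos (2 * pi / real n)"
  define x :: "real^'n" where "x = (\<chi> a. if a \<in> S then 1 else 0)"
  define s where "s = real (card S)"
  have sx: "(\<Sum>a\<in>UNIV. x $ a) = s" and xx: "x \<bullet> x = s"
    by (simp_all add: x_def s_def inner_vec_def sum.If_cases if_distrib cong: if_cong)
  \<comment> \<open>Closedness of \<open>S\<close> makes the factor \<open>x $ b\<close> redundant,
    so the form of the indicator vector is a sum of full rows.\<close>
  have "x $ a * X 1 $ a $ b * x $ b = (if a \<in> S then X 1 $ a $ b else 0)" for a b
    using closed[of a b] X1_binary[of a b] by (auto simp: x_def)
  then have "x \<bullet> (X 1 *v x) = (\<Sum>a\<in>UNIV. \<Sum>b\<in>UNIV. if a \<in> S then X 1 $ a $ b else 0)"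
    by (simp add: inner_matrix_vector_eq_sum)
  also have "\<dots> = (\<Sum>a\<in>UNIV. if a \<in> S then 2 else 0)"
    by (rule sum.cong) (auto simp: X1_row_sum[simplified])
  also have "\<dots> = 2 * s" by (simp add: sum.If_cases s_def)
  finally have "real n * s \<le> s\<^sup>2 + ?c * (real n * s - s\<^sup>2)"
    using X1_bound(1)[of x] by (simp add: sx xx)
  \<comment> \<open>Since \<open>?c < 1\<close>, this forces \<open>n * s \<le> s\<^sup>2\<close>,
    so a nonempty \<open>S\<close> has at least \<open>n\<close> elements.\<close>
  then have "(1 - ?c) * (real n * s - s\<^sup>2) \<le> 0" by (simp add: algebra_simps)
  moreover have "?c < 1"
  proof -
    have "2 * pi / real n \<le> pi" using n(2,3) by (simp add: field_simps)
    then show ?thesis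
      using cos_monotone_0_pi[of 0 "2 * pi / real n"] n(2) by simp
  qed
  ultimately have "real n * s - s\<^sup>2 \<le> 0" by (simp add: mult_le_0_iff)
  moreover have "s > 0" using assms(1) by (simp add: s_def card_gt_0_iff)
  ultimately have "real n \<le> s" by (simp add: power2_eq_square)
  then show ?thesis using n(1) by (intro card_seteq) (simp_all add: s_def)
qed

lemma feasible_hamiltonian_cycle:
  assumes D: "symmetric_matrix D"
  shows "\<exists>C. hamiltonian_cycle complete_graph_edges C \<and> cycle_cost D C = misdp_objective D X"
proof -
  let ?adj = "\<lambda>a b. X 1 $ a $ b = 1"
  let ?C = "{{a, b} | a b. ?adj a b}"
  have "\<exists>vs. distinct vs \<and> set vs = UNIV \<and> 3 \<le> length vs \<and> closed_walk_edges vs = ?C"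
  proof (rule connected_two_regular_cycle)
    show "?adj a b \<Longrightarrow> ?adj b a" for a b using X1_symmetric[of a b] by simp
    show "\<not> ?adj a a" for a using X1_diagonal[of a] by simp
    show "card {b. ?adj a b} = 2" for a by (rule X1_degree)
    show "S = UNIV" if "S \<noteq> {}" "\<And>a b. a \<in> S \<Longrightarrow> ?adj a b \<Longrightarrow> b \<in> S" for S
      using that by (rule X1_connected)
  qed
  moreover have C: "?C \<subseteq> complete_graph_edges"
    using X1_diagonal by (fastforce simp: complete_graph_edges_def)
  ultimately have "hamiltonian_cycle complete_graph_edges ?C"
    unfolding hamiltonian_cycle_def by metis
  moreover have "X 1 $ a $ b = (if {a, b} \<in> ?C then 1 else 0)" for a b
  proof -
    have "{a, b} \<in> ?C \<longleftrightarrow> ?adj a b"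
      using X1_symmetric[of a b] by (auto simp: doubleton_eq_iff)
    then show ?thesis using X1_binary[of a b] by auto
  qed
  from trace_inner_adjacency[OF D C this] have "cycle_cost D ?C = misdp_objective D X"
    by (simp add: misdp_objective_def)
  ultimately show ?thesis by blast
qed

end

theorem theorem12:
  fixes D :: "real^'n^'n" and n r :: nat
  assumes "n = CARD('n)" and "n \<ge> 3" and "odd n"
    and "r = n div 2"
    and "symmetric_matrix D"
  shows "exact_tsp_formulation D (misdp_feasible n r) (misdp_objective D)"
proof -
  have "n = 2 * r + 1" "r \<ge> 1" using assms(2-4) by (auto elim!: oddE)
  then show ?thesis
    unfolding exact_tsp_formulation_def
    using hamiltonian_cycle_feasible feasible_hamiltonian_cycle assms(1,5) by blast
qed

end
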